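(* Let $S$ be a semigroup admitting a left-identity element and let $A$ be a finite set. Suppose that $X\subset A^S$ is a subshift of finite type. Then the dynamical system $(X,S)$ is topologically semistable.
   Context: A left-identity element of $S$ is an element $e\in S$ with $et=t$ for all $t\in S$. $A^S$ is the set of all maps $S\to A$ with the prodiscrete topology (product topology with each factor $A$ discrete), which is compact Hausdorff. $S$ acts continuously on $A^S$ by the shift $(sx)(s')=x(s's)$ for $s,s'\in S$, $x\in A^S$. A subshift is a closed $S$-invariant subset $X\subset A^S$; $(X,S)$ denotes $X$ with the restricted shift action. A subshift $X$ is of finite type if there exist a finite subset $W\subset S$ and $P\subset A^W$ such that $X=\{x\in A^S : (sx)|_W\in P \text{ for all } s\in S\}$. A compact Hausdorff space $X$ carries a unique uniform structure inducing its topology; its entourages are the neighborhoods of the diagonal in $X\times X$. A continuous semigroup action of $S$ on $X$ is a family of continuous maps $\alpha_s\colon X\to X$ with $\alpha_s\circ\alpha_{s'}=\alpha_{ss'}$ for all $s,s'\in S$. $\mathrm{CSA}_S(X)$ is the set of all such actions, with the topology of the uniform structure having as a base of entourages the sets $\{(\alpha,\beta): (\alpha_k(x),\beta_k(x))\in U \text{ for all } k\in K, x\in X\}$, where $K$ runs over finite subsets of $S$ and $U$ over entourages of $X$. $(X,S,\alpha)$ is topologically semistable if there is a neighborhood $N$ of $\alpha$ in $\mathrm{CSA}_S(X)$ such that for every $\beta\in N$ there is a continuous map $h\colon X\to X$ with $\alpha_s\circ h=h\circ\beta_s$ for all $s\in S$. *)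

theory Defs
  imports "HOL-Analysis.Analysis"
begin

section \<open>Continuous semigroup actions on a compact Hausdorff space\<close>

text \<open>
  The semigroup \<open>S\<close> is the type \<^typ>\<open>'s::semigroup_mult\<close>; spaces are abstract topologies.
  Self-maps of a space \<open>X\<close> are represented by extensional functions, so that equality of actions
  is equality on the points of \<open>X\<close>. Actions are not required to be unital.
\<close>

definition left_identity :: "'s::semigroup_mult \<Rightarrow> bool" where
  "left_identity e \<longleftrightarrow> (\<forall>t. e * t = t)"

definition CSA :: "'x topology \<Rightarrow> ('s::semigroup_mult \<Rightarrow> 'x \<Rightarrow> 'x) set" where
  "CSA X = {\<alpha>. (\<forall>s. continuous_map X X (\<alpha> s) \<and> \<alpha> s \<in> extensional (topspace X)) \<and>
                (\<forall>s s'. \<forall>x\<in>topspace X. \<alpha> s (\<alpha> s' x) = \<alpha> (s * s') x)}"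

text \<open>The entourages of the unique uniform structure of a compact Hausdorff space \<open>X\<close>, namely
  the neighbourhoods of the diagonal.\<close>

definition entourages :: "'x topology \<Rightarrow> ('x \<times> 'x) set set" where
  "entourages X = {U. U \<subseteq> topspace X \<times> topspace X \<and>
     (\<exists>V. openin (prod_topology X X) V \<and> (\<forall>x\<in>topspace X. (x, x) \<in> V) \<and> V \<subseteq> U)}"

definition CSA_entourage ::
  "'x topology \<Rightarrow> 's::semigroup_mult set \<Rightarrow> ('x \<times> 'x) set
     \<Rightarrow> (('s \<Rightarrow> 'x \<Rightarrow> 'x) \<times> ('s \<Rightarrow> 'x \<Rightarrow> 'x)) set" where
  "CSA_entourage X K U = {(\<alpha>, \<beta>). \<alpha> \<in> CSA X \<and> \<beta> \<in> CSA X \<and>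
     (\<forall>k\<in>K. \<forall>x\<in>topspace X. (\<alpha> k x, \<beta> k x) \<in> U)}"

text \<open>The topology induced by the uniform structure with base the sets
  \<^term>\<open>CSA_entourage X K U\<close>, for \<open>K\<close> finite and \<open>U\<close> an entourage of \<open>X\<close>.\<close>

definition CSA_topology :: "'x topology \<Rightarrow> ('s::semigroup_mult \<Rightarrow> 'x \<Rightarrow> 'x) topology" where
  "CSA_topology X = topology (\<lambda>G. G \<subseteq> CSA X \<and>
     (\<forall>\<alpha>\<in>G. \<exists>K U. finite K \<and> U \<in> entourages X \<and> CSA_entourage X K U `` {\<alpha>} \<subseteq> G))"

lemma entourages_Int:
  assumes "U \<in> entourages X" "U' \<in> entourages X"
  shows "U \<inter> U' \<in> entourages X"
proof -
  obtain V V' where "openin (prod_topology X X) V" "\<forall>x\<in>topspace X. (x, x) \<in> V" "V \<subseteq> U"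
    "openin (prod_topology X X) V'" "\<forall>x\<in>topspace X. (x, x) \<in> V'" "V' \<subseteq> U'"
    using assms unfolding entourages_def by blast
  then have "openin (prod_topology X X) (V \<inter> V') \<and> (\<forall>x\<in>topspace X. (x, x) \<in> V \<inter> V') \<and>
      V \<inter> V' \<subseteq> U \<inter> U'"
    by blast
  then show ?thesis
    using assms unfolding entourages_def by blast
qed

lemma entourages_full: "topspace X \<times> topspace X \<in> entourages X"
  unfolding entourages_def
  using openin_topspace[of "prod_topology X X"] by (auto simp: topspace_prod_topology)

lemma openin_CSA_topology:
  fixes X :: "'x topology" and G :: "('s::semigroup_mult \<Rightarrow> 'x \<Rightarrow> 'x) set"
  shows "openin (CSA_topology X) G \<longleftrightarrow> G \<subseteq> CSA X \<and>
     (\<forall>\<alpha>\<in>G. \<exists>K U. finite K \<and> U \<in> entourages X \<and> CSA_entourage X K U `` {\<alpha>} \<subseteq> G)"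
proof -
  let ?P = "\<lambda>G :: ('s::semigroup_mult \<Rightarrow> 'x \<Rightarrow> 'x) set. G \<subseteq> CSA X \<and>
     (\<forall>\<alpha>\<in>G. \<exists>K U. finite K \<and> U \<in> entourages X \<and> CSA_entourage X K U `` {\<alpha>} \<subseteq> G)"
  have "istopology ?P"
    unfolding istopology_def
  proof (intro conjI allI impI)
    fix G H assume GH: "?P G" "?P H"
    have "\<exists>K U. finite K \<and> U \<in> entourages X \<and> CSA_entourage X K U `` {\<alpha>} \<subseteq> G \<inter> H"
      if \<alpha>: "\<alpha> \<in> G \<inter> H" for \<alpha>
    proof -
      obtain K U where K: "finite K" "U \<in> entourages X" "CSA_entourage X K U `` {\<alpha>} \<subseteq> G"
        using GH(1) \<alpha> by blast
      obtain K' U' where K': "finite K'" "U' \<in> entourages X" "CSA_entourage X K' U' `` {\<alpha>} \<subseteq> H"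
        using GH(2) \<alpha> by blast
      have "CSA_entourage X (K \<union> K') (U \<inter> U')
          \<subseteq> CSA_entourage X K U \<inter> CSA_entourage X K' U'"
        unfolding CSA_entourage_def by auto
      then have "CSA_entourage X (K \<union> K') (U \<inter> U') `` {\<alpha>} \<subseteq> G \<inter> H"
        using K(3) K'(3) by blast
      with K K' show ?thesis
        by (meson entourages_Int finite_UnI)
    qed
    then show "G \<inter> H \<subseteq> CSA X" and "\<forall>\<alpha>\<in>G \<inter> H. \<exists>K U. finite K \<and> U \<in> entourages X \<and>
        CSA_entourage X K U `` {\<alpha>} \<subseteq> G \<inter> H"
      using GH by blast+
  next
    fix \<G> assume *: "\<forall>G\<in>\<G>. ?P G"
    then show "\<Union>\<G> \<subseteq> CSA X" by blast
    show "\<forall>\<alpha>\<in>\<Union>\<G>. \<exists>K U. finite K \<and> U \<in> entourages X \<and> CSA_entourage X K U `` {\<alpha>} \<subseteq> \<Union>\<G>"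
    proof
      fix \<alpha> assume "\<alpha> \<in> \<Union>\<G>"
      then obtain G where "G \<in> \<G>" "\<alpha> \<in> G" by blast
      with * obtain K U where "finite K" "U \<in> entourages X" "CSA_entourage X K U `` {\<alpha>} \<subseteq> G"
        by blast
      with \<open>G \<in> \<G>\<close>
      show "\<exists>K U. finite K \<and> U \<in> entourages X \<and> CSA_entourage X K U `` {\<alpha>} \<subseteq> \<Union>\<G>"
        by blast
    qed
  qed
  then show ?thesis
    unfolding CSA_topology_def by (simp add: topology_inverse')
qed

lemma topspace_CSA_topology: "topspace (CSA_topology X) = CSA X"
proof -
  have "openin (CSA_topology X) (CSA X)"
    unfolding openin_CSA_topology
    using entourages_full[of X] by (fastforce simp: CSA_entourage_def intro: finite.emptyI)
  then show ?thesis
    by (meson openin_CSA_topology openin_subset openin_topspace subset_antisym)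
qed

definition topologically_semistable ::
  "'x topology \<Rightarrow> ('s::semigroup_mult \<Rightarrow> 'x \<Rightarrow> 'x) \<Rightarrow> bool" where
  "topologically_semistable X \<alpha> \<longleftrightarrow>
     \<alpha> \<in> CSA X \<and>
     (\<exists>N \<subseteq> CSA X. (\<exists>G. openin (CSA_topology X) G \<and> \<alpha> \<in> G \<and> G \<subseteq> N) \<and>
        (\<forall>\<beta>\<in>N. \<exists>h. continuous_map X X h \<and>
           (\<forall>s. \<forall>x\<in>topspace X. \<alpha> s (h x) = h (\<beta> s x))))"


section \<open>Shifts and subshifts\<close>

definition config_space :: "'a set \<Rightarrow> ('s \<Rightarrow> 'a) topology" where
  "config_space A = product_topology (\<lambda>_. discrete_topology A) UNIV"

definition shift :: "'s::semigroup_mult \<Rightarrow> ('s \<Rightarrow> 'a) \<Rightarrow> ('s \<Rightarrow> 'a)" where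
  "shift s x = (\<lambda>s'. x (s' * s))"

definition subshift :: "'a set \<Rightarrow> ('s::semigroup_mult \<Rightarrow> 'a) set \<Rightarrow> bool" where
  "subshift A X \<longleftrightarrow> closedin (config_space A) X \<and> (\<forall>s. \<forall>x\<in>X. shift s x \<in> X)"

definition subshift_of_finite_type :: "'a set \<Rightarrow> ('s::semigroup_mult \<Rightarrow> 'a) set \<Rightarrow> bool" where
  "subshift_of_finite_type A X \<longleftrightarrow> subshift A X \<and>
     (\<exists>W P. finite W \<and> P \<subseteq> (W \<rightarrow>\<^sub>E A) \<and>
        X = {x \<in> topspace (config_space A). \<forall>s. restrict (shift s x) W \<in> P})"

definition subshift_space :: "'a set \<Rightarrow> ('s \<Rightarrow> 'a) set \<Rightarrow> ('s \<Rightarrow> 'a) topology" where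
  "subshift_space A X = subtopology (config_space A) X"

definition shift_action ::
  "('s::semigroup_mult \<Rightarrow> 'a) set \<Rightarrow> 's \<Rightarrow> ('s \<Rightarrow> 'a) \<Rightarrow> ('s \<Rightarrow> 'a)" where
  "shift_action X s = restrict (shift s) X"

end

theory Submission
  imports Defs
begin

text \<open>
  Write \<open>\<alpha>\<close> for the shift action on \<open>X\<close> and let \<open>e\<close> be a left identity. Evaluation at \<open>e\<close> recovers a
  configuration from its orbit under the shift, since \<open>(sx)(e) = x(es) = x(s)\<close>. For another action
  \<open>\<beta>\<close> on \<open>X\<close> this suggests the itinerary map \<open>h(x)(s) = (\<beta>\<^sub>s x)(e)\<close>. It is continuous, and the
  composition law \<open>\<beta>\<^sub>s \<beta>\<^sub>t = \<beta>\<^bsub>st\<^esub>\<close> alone makes it intertwine \<open>\<beta>\<close> with the shift of the full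
  configuration space. The whole content is therefore that \<open>h\<close> lands in \<open>X\<close>, and here both the finite
  type hypothesis and the closeness of \<open>\<beta>\<close> to \<open>\<alpha>\<close> enter.

  Let \<open>W\<close> and \<open>P\<close> define \<open>X\<close>. By equivariance the pattern of \<open>s h(x)\<close> on \<open>W\<close> is the pattern of
  \<open>h(y)\<close>, where \<open>y = \<beta>\<^sub>s x\<close>. If \<open>\<beta>\<^sub>w\<close> and \<open>\<alpha>\<^sub>w\<close> agree at \<open>e\<close> for every \<open>w \<in> W\<close>, then
  \<open>h(y)(w) = y(w)\<close> on \<open>W\<close>. The element \<open>e\<close> need not act trivially under \<open>\<alpha>\<close>, so a general point of
  \<open>X\<close> need not have its pattern on \<open>W\<close> in \<open>P\<close>; but \<open>es = s\<close> gives \<open>\<beta>\<^sub>e y = y\<close>. So if \<open>\<beta>\<^sub>e\<close> and \<open>\<alpha>\<^sub>e\<close>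
  also agree on \<open>W\<close>, then \<open>y\<close> has on \<open>W\<close> the same pattern as \<open>ey\<close>, which lies in \<open>P\<close>. Hence it
  suffices that \<open>\<beta>\<^sub>k x\<close> and \<open>\<alpha>\<^sub>k x\<close> agree on \<open>W \<union> {e}\<close> for all \<open>k \<in> W \<union> {e}\<close> and \<open>x \<in> X\<close>, an open
  condition on \<open>\<beta>\<close>.
\<close>

lemma topspace_config_space: "topspace (config_space A) = {x. \<forall>s. x s \<in> A}"
  unfolding config_space_def by (auto simp: PiE_def Pi_def)

lemma topspace_subshift_space:
  assumes "X \<subseteq> topspace (config_space A)"
  shows "topspace (subshift_space A X) = X"
  using assms unfolding subshift_space_def by auto

lemma continuous_map_into_subshift_space:
  assumes "X \<subseteq> topspace (config_space A)"
  shows "continuous_map Y (subshift_space A X) f \<longleftrightarrow>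
    (\<forall>s. continuous_map Y (discrete_topology A) (\<lambda>x. f x s)) \<and> f \<in> topspace Y \<rightarrow> X"
  using assms unfolding subshift_space_def config_space_def
  by (auto simp: continuous_map_in_subtopology continuous_map_componentwise_UNIV)

lemma continuous_map_subshift_coordinate:
  "continuous_map (subshift_space A X) (discrete_topology A) (\<lambda>x. x s)"
  unfolding subshift_space_def config_space_def
  by (intro continuous_map_from_subtopology continuous_map_product_projection) simp

lemma shift_action_in_CSA:
  assumes "subshift A X"
  shows "shift_action X \<in> CSA (subshift_space A X)"
proof -
  have X: "X \<subseteq> topspace (config_space A)"
    using assms by (simp add: subshift_def closedin_subset)
  have inv: "shift s x \<in> X" if "x \<in> X" for s x
    using assms that by (simp add: subshift_def)
  have "continuous_map (subshift_space A X) (subshift_space A X) (shift s)" for s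
    unfolding continuous_map_into_subshift_space[OF X]
    using inv by (auto simp: topspace_subshift_space[OF X] shift_def
        intro: continuous_map_subshift_coordinate)
  then have "continuous_map (subshift_space A X) (subshift_space A X) (shift_action X s)" for s
    by (rule continuous_map_eq) (simp add: shift_action_def topspace_subshift_space[OF X])
  then show ?thesis
    unfolding CSA_def
    using inv by (auto simp: topspace_subshift_space[OF X] shift_action_def)
      (auto simp: shift_def mult.assoc)
qed

text \<open>The ball around \<open>\<alpha>\<close> contains the ball of the same size around each of its points, because
  \<open>U\<close> is transitive.\<close>

lemma openin_CSA_ball:
  assumes "finite K" "U \<in> entourages X" "trans U"
  shows "openin (CSA_topology X) (CSA_entourage X K U `` {\<alpha>})"
  unfolding openin_CSA_topology
proof (intro conjI ballI)
  show "CSA_entourage X K U `` {\<alpha>} \<subseteq> CSA X"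
    by (auto simp: CSA_entourage_def)
  fix \<beta> assume "\<beta> \<in> CSA_entourage X K U `` {\<alpha>}"
  then have "CSA_entourage X K U `` {\<beta>} \<subseteq> CSA_entourage X K U `` {\<alpha>}"
    using \<open>trans U\<close> by (fastforce simp: CSA_entourage_def dest: transD)
  then show "\<exists>K' U'. finite K' \<and> U' \<in> entourages X \<and>
      CSA_entourage X K' U' `` {\<beta>} \<subseteq> CSA_entourage X K U `` {\<alpha>}"
    using assms by blast
qed

definition agreement_on :: "'s set \<Rightarrow> ('s \<Rightarrow> 'a) set \<Rightarrow> (('s \<Rightarrow> 'a) \<times> ('s \<Rightarrow> 'a)) set" where
  "agreement_on F X = {(x, y) \<in> X \<times> X. \<forall>k\<in>F. x k = y k}"

lemma trans_agreement_on: "trans (agreement_on F X)"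
  by (auto simp: agreement_on_def trans_def)

lemma agreement_on_in_entourages:
  assumes X: "X \<subseteq> topspace (config_space A)" and "finite F"
  shows "agreement_on F X \<in> entourages (subshift_space A X)"
proof -
  let ?T = "subshift_space A X"
  have coord: "openin ?T {x \<in> X. x k = a}" for k a
  proof -
    have "openin ?T {x \<in> topspace ?T. x k \<in> {a} \<inter> A}"
      by (rule openin_continuous_map_preimage[OF continuous_map_subshift_coordinate]) simp
    moreover have "{x \<in> topspace ?T. x k \<in> {a} \<inter> A} = {x \<in> X. x k = a}"
      using X by (auto simp: topspace_subshift_space[OF X] topspace_config_space)
    ultimately show ?thesis by simp
  qed
  have "openin (prod_topology ?T ?T) (agreement_on F X)"
    using \<open>finite F\<close>
  proof (induction F rule: finite_induct)
    case empty
    have "agreement_on {} X = topspace (prod_topology ?T ?T)"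
      by (auto simp: agreement_on_def topspace_subshift_space[OF X])
    then show ?case by (metis openin_topspace)
  next
    case (insert k F)
    have "agreement_on (insert k F) X =
        (\<Union>a. {x \<in> X. x k = a} \<times> {x \<in> X. x k = a}) \<inter> agreement_on F X"
      by (auto simp: agreement_on_def)
    moreover have "openin (prod_topology ?T ?T) (\<Union>a. {x \<in> X. x k = a} \<times> {x \<in> X. x k = a})"
      using coord by (intro openin_Union) (auto simp: openin_prod_Times_iff)
    ultimately show ?case
      using insert.IH by auto
  qed
  then show ?thesis
    unfolding entourages_def
    by (auto simp: topspace_subshift_space[OF X] agreement_on_def
        intro!: exI[of _ "agreement_on F X"])
qed

definition itinerary :: "'s \<Rightarrow> ('s \<Rightarrow> ('s \<Rightarrow> 'a) \<Rightarrow> ('s \<Rightarrow> 'a)) \<Rightarrow> ('s \<Rightarrow> 'a) \<Rightarrow> ('s \<Rightarrow> 'a)" where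
  "itinerary e \<beta> x = (\<lambda>s. \<beta> s x e)"

lemma shift_itinerary:
  assumes "\<beta> \<in> CSA T" "x \<in> topspace T"
  shows "shift s (itinerary e \<beta> x) = itinerary e \<beta> (\<beta> s x)"
  using assms by (auto simp: CSA_def shift_def itinerary_def)

text \<open>The pattern on \<open>W\<close> of the translate by \<open>s\<close> of the itinerary of \<open>x\<close> is that of the point \<open>y = \<beta> s x\<close>, and
  \<open>\<beta> e y = y\<close>. Such a \<open>y\<close> agrees on \<open>W\<close> with its translate by \<open>e\<close>, whose pattern is allowed.\<close>

lemma itinerary_in_finite_type:
  assumes e: "left_identity e"
    and X: "X = {x \<in> topspace (config_space A). \<forall>s. restrict (shift s x) W \<in> P}"
    and \<beta>: "\<beta> \<in> CSA (subshift_space A X)"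
    and close: "\<And>k x. k \<in> insert e W \<Longrightarrow> x \<in> X \<Longrightarrow>
      (shift_action X k x, \<beta> k x) \<in> agreement_on (insert e W) X"
    and x: "x \<in> X"
  shows "itinerary e \<beta> x \<in> X"
proof -
  have sub: "X \<subseteq> topspace (config_space A)"
    using X by blast
  note top = topspace_subshift_space[OF sub]
  have maps: "\<beta> s y \<in> X" if "y \<in> X" for s y
    using \<beta> that top unfolding CSA_def continuous_map_def by blast
  have "restrict (shift s (itinerary e \<beta> x)) W \<in> P" for s
  proof -
    define y where "y = \<beta> s x"
    have y: "y \<in> X"
      using maps x by (simp add: y_def)
    have "\<beta> e y = y"
      using \<beta> x e top by (simp add: CSA_def y_def left_identity_def)
    then have "y w = shift e y w" if "w \<in> W" for w
      using close[of e y] that y by (auto simp: agreement_on_def shift_action_def)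
    moreover have "itinerary e \<beta> y w = y w" if "w \<in> W" for w
      using close[of w y] that y e
      by (auto simp: agreement_on_def shift_action_def itinerary_def shift_def left_identity_def)
    moreover have "shift s (itinerary e \<beta> x) = itinerary e \<beta> y"
      using shift_itinerary[OF \<beta>] x top by (simp add: y_def)
    ultimately have "restrict (shift s (itinerary e \<beta> x)) W = restrict (shift e y) W"
      by (simp add: restrict_def fun_eq_iff)
    then show ?thesis
      using y X by auto
  qed
  moreover have "itinerary e \<beta> x \<in> topspace (config_space A)"
    using maps[OF x] sub by (auto simp: itinerary_def topspace_config_space)
  ultimately show ?thesis
    using X by blast
qed

lemma continuous_map_itinerary:
  assumes X: "X \<subseteq> topspace (config_space A)"
    and \<beta>: "\<beta> \<in> CSA (subshift_space A X)"
    and into: "\<And>x. x \<in> X \<Longrightarrow> itinerary e \<beta> x \<in> X"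
  shows "continuous_map (subshift_space A X) (subshift_space A X) (itinerary e \<beta>)"
  unfolding continuous_map_into_subshift_space[OF X]
proof (intro conjI allI)
  fix s
  have "continuous_map (subshift_space A X) (subshift_space A X) (\<beta> s)"
    using \<beta> by (simp add: CSA_def)
  then show "continuous_map (subshift_space A X) (discrete_topology A) (\<lambda>x. itinerary e \<beta> x s)"
    unfolding itinerary_def continuous_map_into_subshift_space[OF X] by blast
qed (use into topspace_subshift_space[OF X] in auto)

theorem corollary4p11:
  fixes A :: "'a set" and X :: "('s::semigroup_mult \<Rightarrow> 'a) set"
  assumes "\<exists>e::'s. left_identity e"
    and "finite A"
    and "subshift_of_finite_type A X"
  shows "topologically_semistable (subshift_space A X) (shift_action X)"
proof -
  let ?T = "subshift_space A X"
  obtain e :: 's where e: "left_identity e"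
    using assms(1) by blast
  obtain W P where "finite W"
    and X: "X = {x \<in> topspace (config_space A). \<forall>s. restrict (shift s x) W \<in> P}"
    using assms(3) unfolding subshift_of_finite_type_def by blast
  have sub: "X \<subseteq> topspace (config_space A)"
    using X by blast
  note top = topspace_subshift_space[OF sub]
  have \<alpha>: "shift_action X \<in> CSA ?T"
    using assms(3) shift_action_in_CSA unfolding subshift_of_finite_type_def by blast
  let ?F = "insert e W"
  define N where "N = CSA_entourage ?T ?F (agreement_on ?F X) `` {shift_action X}"
  have "openin (CSA_topology ?T) N"
    unfolding N_def using \<open>finite W\<close>
    by (intro openin_CSA_ball agreement_on_in_entourages[OF sub] trans_agreement_on) auto
  moreover have "shift_action X \<in> N"
    using \<alpha> top
    by (fastforce simp: N_def CSA_entourage_def agreement_on_def CSA_def continuous_map_def)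
  moreover have "\<exists>h. continuous_map ?T ?T h \<and>
      (\<forall>s. \<forall>x\<in>topspace ?T. shift_action X s (h x) = h (\<beta> s x))" if "\<beta> \<in> N" for \<beta>
  proof -
    have close: "(shift_action X k x, \<beta> k x) \<in> agreement_on ?F X"
      if "k \<in> ?F" "x \<in> X" for k x
      using \<open>\<beta> \<in> N\<close> that top by (auto simp: N_def CSA_entourage_def)
    have \<beta>: "\<beta> \<in> CSA ?T"
      using \<open>\<beta> \<in> N\<close> by (auto simp: N_def CSA_entourage_def)
    have into: "itinerary e \<beta> x \<in> X" if "x \<in> X" for x
      using itinerary_in_finite_type[OF e X \<beta> close that] by blast
    show ?thesis
    proof (intro exI[of _ "itinerary e \<beta>"] conjI allI ballI)
      show "continuous_map ?T ?T (itinerary e \<beta>)"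
        using continuous_map_itinerary[OF sub \<beta> into] .
      show "shift_action X s (itinerary e \<beta> x) = itinerary e \<beta> (\<beta> s x)"
        if "x \<in> topspace ?T" for s x
        using that into top shift_itinerary[OF \<beta> that] by (simp add: shift_action_def)
    qed
  qed
  ultimately show ?thesis
    unfolding topologically_semistable_def
    using \<alpha> openin_subset[of "CSA_topology ?T" N]
    by (intro conjI exI[of _ N]) (auto simp: topspace_CSA_topology)
qed

end
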